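(* Let $A$ be a finite abelian group, and let $G \in \mathcal{G}'_\infty$ be a group which acts by automorphisms without $A$-cancellation on a one-sided full shift $\Sigma^{\mathbb{N}}$ for some finite alphabet $\Sigma$. Then the restricted wreath product $A\wr G$ belongs to $\mathcal{G}'_\infty$.
   Context: For a finite alphabet $\Sigma$ with $|\Sigma|\ge 2$, $\mathrm{Aut}(\Sigma^{\mathbb{N}})$ is the group of homeomorphisms of $\Sigma^{\mathbb{N}}$ commuting with the one-sided shift $\sigma(x)_i = x_{i+1}$. $\mathcal{G}'_n$ is the class of groups isomorphic to a subgroup of $\mathrm{Aut}(\Sigma^{\mathbb{N}})$ where $|\Sigma| = n$, and $\mathcal{G}'_\infty = \bigcup_n \mathcal{G}'_n$. Acting by automorphisms means acting through a homomorphism $G\to \mathrm{Aut}(\Sigma^{\mathbb{N}})$. A $G$-system $(G,X)$ is a zero-dimensional compact metrizable space $X$ with an action of the discrete group $G$ by homeomorphisms. Let $A$, $B$ be finite abelian groups and $\theta : X \to \mathrm{Hom}(A,B)$ continuous ($\mathrm{Hom}(A,B)$ discrete). $(G,X)$ has $A$-cancellation with respect to $(\theta,B)$ if there exists a finitely supported map $f : G\to A$, $f\neq 0$, such that $\sum_{g\in G}\theta(gx)(f(g)) = 0$ for all $x\in X$. $(G,X)$ has $A$-cancellation if it has $A$-cancellation with respect to every such $(\theta,B)$ (for all finite abelian $B$); otherwise it is without $A$-cancellation. $A\wr G = \left(\bigoplus_{G} A\right)\rtimes G$ is the restricted wreath product. *)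

theory Defs
  imports
    "HOL-Analysis.Analysis"
    "HOL-Algebra.Bij"
    "HOL-Algebra.Free_Abelian_Groups"
begin

definition full_shift :: "'s set \<Rightarrow> (nat \<Rightarrow> 's) topology" where
  "full_shift \<Sigma> = product_topology (\<lambda>_. discrete_topology \<Sigma>) UNIV"

definition shift :: "(nat \<Rightarrow> 's) \<Rightarrow> nat \<Rightarrow> 's" where
  "shift x = (\<lambda>i. x (Suc i))"

text \<open>As in \<open>BijGroup\<close>, the automorphisms are taken to be extensional on the space, so that
  equality of group elements is equality of maps on \<open>\<Sigma>\<^sup>\<nat>\<close>.\<close>

definition shift_auts :: "'s set \<Rightarrow> ((nat \<Rightarrow> 's) \<Rightarrow> nat \<Rightarrow> 's) set" where
  "shift_auts \<Sigma> =
     {f \<in> Bij (topspace (full_shift \<Sigma>)).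
        homeomorphic_map (full_shift \<Sigma>) (full_shift \<Sigma>) f \<and>
        (\<forall>x \<in> topspace (full_shift \<Sigma>). f (shift x) = shift (f x))}"

definition shift_Aut :: "'s set \<Rightarrow> ((nat \<Rightarrow> 's) \<Rightarrow> nat \<Rightarrow> 's) monoid" where
  "shift_Aut \<Sigma> = (BijGroup (topspace (full_shift \<Sigma>))) \<lparr>carrier := shift_auts \<Sigma>\<rparr>"

text \<open>Up to isomorphism \<open>shift_Aut \<Sigma>\<close> depends only on the cardinality of \<open>\<Sigma>\<close>, so it is
  enough to let the alphabets range over finite sets of natural numbers.\<close>

definition in_class :: "nat \<Rightarrow> ('g, 'm) monoid_scheme \<Rightarrow> bool" where
  "in_class n G \<longleftrightarrow> group G \<and>
     (\<exists>(\<Sigma> :: nat set) H. finite \<Sigma> \<and> card \<Sigma> = n \<and> n \<ge> 2 \<and>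
        subgroup H (shift_Aut \<Sigma>) \<and> G \<cong> (shift_Aut \<Sigma>)\<lparr>carrier := H\<rparr>)"

definition in_class_infinity :: "('g, 'm) monoid_scheme \<Rightarrow> bool" where
  "in_class_infinity G \<longleftrightarrow> (\<exists>n. in_class n G)"

text \<open>The groups \<open>A\<close>, \<open>B\<close> are written multiplicatively. Homomorphisms are extensional on
  \<open>A\<close>, so that they are determined by their values on the carrier.\<close>

definition Hom :: "('a, 'm) monoid_scheme \<Rightarrow> ('b, 'n) monoid_scheme \<Rightarrow> ('a \<Rightarrow> 'b) set" where
  "Hom A B = hom A B \<inter> extensional (carrier A)"

text \<open>In the next two definitions the discrete group \<open>G\<close> acts on the space \<open>X\<close> through \<open>\<phi>\<close>,
  the point \<open>gx\<close> being \<open>\<phi> g x\<close>. The carrier of \<open>sum_group\<close> consists of the finitely supported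
  maps from \<open>G\<close> to \<open>A\<close>, and \<open>gfinprod\<close> is the product over the support of its argument.\<close>

definition cancellation_wrt ::
  "('a, 'm) monoid_scheme \<Rightarrow> ('g, 'n) monoid_scheme \<Rightarrow> 'x topology \<Rightarrow> ('g \<Rightarrow> 'x \<Rightarrow> 'x) \<Rightarrow>
   ('x \<Rightarrow> 'a \<Rightarrow> 'b) \<Rightarrow> ('b, 'k) monoid_scheme \<Rightarrow> bool" where
  "cancellation_wrt A G X \<phi> \<theta> B \<longleftrightarrow>
     (\<exists>f \<in> carrier (sum_group (carrier G) (\<lambda>_. A)).
        f \<noteq> \<one>\<^bsub>sum_group (carrier G) (\<lambda>_. A)\<^esub> \<and>
        (\<forall>x \<in> topspace X. gfinprod B (\<lambda>g. \<theta> (\<phi> g x) (f g)) (carrier G) = \<one>\<^bsub>B\<^esub>))"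

text \<open>Every finite group is isomorphic to one whose carrier is a set of natural numbers;
  \<open>cancellation_wrt_any\<close> below shows that nothing is lost by restricting \<open>B\<close> to these.\<close>

definition cancellation ::
  "('a, 'm) monoid_scheme \<Rightarrow> ('g, 'n) monoid_scheme \<Rightarrow> 'x topology \<Rightarrow> ('g \<Rightarrow> 'x \<Rightarrow> 'x) \<Rightarrow> bool" where
  "cancellation A G X \<phi> \<longleftrightarrow>
     (\<forall>(B :: nat monoid) \<theta>.
        comm_group B \<longrightarrow> finite (carrier B) \<longrightarrow>
        continuous_map X (discrete_topology (Hom A B)) \<theta> \<longrightarrow>
        cancellation_wrt A G X \<phi> \<theta> B)"

definition wreath ::
  "('a, 'm) monoid_scheme \<Rightarrow> ('g, 'n) monoid_scheme \<Rightarrow> (('g \<Rightarrow> 'a) \<times> 'g) monoid" where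
  "wreath A G =
     \<lparr>carrier = carrier (sum_group (carrier G) (\<lambda>_. A)) \<times> carrier G,
      mult = (\<lambda>(f, g) (f', g').
        (f \<otimes>\<^bsub>sum_group (carrier G) (\<lambda>_. A)\<^esub> (\<lambda>h \<in> carrier G. f' (inv\<^bsub>G\<^esub> g \<otimes>\<^bsub>G\<^esub> h)),
         g \<otimes>\<^bsub>G\<^esub> g')),
      one = (\<one>\<^bsub>sum_group (carrier G) (\<lambda>_. A)\<^esub>, \<one>\<^bsub>G\<^esub>)\<rparr>"

lemma finite_comm_group_iso_nat:
  fixes B :: "('b, 'k) monoid_scheme"
  assumes "comm_group B" "finite (carrier B)"
  obtains B' :: "nat monoid" and h
  where "comm_group B'" "finite (carrier B')" "h \<in> iso B B'"
proof -
  interpret B: comm_group B by fact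
  obtain h :: "'b \<Rightarrow> nat" where inj: "inj_on h (carrier B)"
    using assms(2) finite_imp_inj_to_nat_seg by blast
  define k where "k = inv_into (carrier B) h"
  have k [simp]: "k (h b) = b" if "b \<in> carrier B" for b
    using inj that by (simp add: k_def)
  define B' :: "nat monoid" where
    "B' = \<lparr>carrier = h ` carrier B, mult = (\<lambda>x y. h (k x \<otimes>\<^bsub>B\<^esub> k y)), one = h \<one>\<^bsub>B\<^esub>\<rparr>"
  have *: "comm_group B'"
  proof (rule comm_groupI)
    show "\<exists>y\<in>carrier B'. y \<otimes>\<^bsub>B'\<^esub> x = \<one>\<^bsub>B'\<^esub>" if "x \<in> carrier B'" for x
      using that by (auto simp: B'_def intro!: bexI [where x = "inv\<^bsub>B\<^esub> k x"])
  qed (auto simp: B'_def B.m_ac)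
  moreover have "h \<in> iso B B'"
    using inj by (auto simp: iso_def hom_def B'_def bij_betw_def)
  ultimately show ?thesis
    using that assms(2) by (auto simp: B'_def)
qed

lemma cancellation_wrt_any:
  fixes B :: "('b, 'k) monoid_scheme"
  assumes "group A"
    and act: "\<And>g. g \<in> carrier G \<Longrightarrow> \<phi> g \<in> topspace X \<rightarrow> topspace X"
    and canc: "cancellation A G X \<phi>"
    and B: "comm_group B" "finite (carrier B)"
    and \<theta>: "continuous_map X (discrete_topology (Hom A B)) \<theta>"
  shows "cancellation_wrt A G X \<phi> \<theta> B"
proof -
  obtain B' :: "nat monoid" and h
    where B': "comm_group B'" "finite (carrier B')" and h: "h \<in> iso B B'"
    using finite_comm_group_iso_nat B by metis
  interpret B: comm_group B by fact
  interpret B': comm_group B' by fact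
  have inj: "inj_on h (carrier B)" and hom: "h \<in> hom B B'"
    using h by (auto simp: iso_def bij_betw_def)
  interpret h: group_hom B B' h
    by unfold_locales (use hom in auto)
  define \<theta>' where "\<theta>' = (\<lambda>x. compose (carrier A) h (\<theta> x))"
  have "compose (carrier A) h u \<in> Hom A B'" if "u \<in> Hom A B" for u
    using that \<open>group A\<close> by (auto simp: Hom_def hom_def compose_def Pi_iff group.is_monoid monoid.m_closed)
  then have "continuous_map (discrete_topology (Hom A B)) (discrete_topology (Hom A B'))
      (compose (carrier A) h)"
    by auto
  with \<theta> have "continuous_map X (discrete_topology (Hom A B')) \<theta>'"
    unfolding \<theta>'_def using continuous_map_compose [unfolded comp_def] by blast
  with canc B' obtain f where
    f: "f \<in> carrier (sum_group (carrier G) (\<lambda>_. A))" "f \<noteq> \<one>\<^bsub>sum_group (carrier G) (\<lambda>_. A)\<^esub>"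
    and eq: "\<And>x. x \<in> topspace X \<Longrightarrow>
      gfinprod B' (\<lambda>g. \<theta>' (\<phi> g x) (f g)) (carrier G) = \<one>\<^bsub>B'\<^esub>"
    unfolding cancellation_def cancellation_wrt_def by blast
  have fA: "f g \<in> carrier A" if "g \<in> carrier G" for g
    using f(1) that \<open>group A\<close> by (auto simp: carrier_sum_group)
  have fin: "finite {g \<in> carrier G. f g \<noteq> \<one>\<^bsub>A\<^esub>}"
    using f(1) \<open>group A\<close> by (auto simp: carrier_sum_group)
  have "gfinprod B (\<lambda>g. \<theta> (\<phi> g x) (f g)) (carrier G) = \<one>\<^bsub>B\<^esub>" if x: "x \<in> topspace X" for x
  proof -
    have Hom: "\<theta> (\<phi> g x) \<in> Hom A B" if "g \<in> carrier G" for g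
      using \<theta> act [OF that] x by (auto simp: continuous_map_def Pi_iff)
    then have val: "\<theta> (\<phi> g x) (f g) \<in> carrier B" if "g \<in> carrier G" for g
      using Hom [OF that] fA [OF that] by (auto simp: Hom_def hom_def)
    define S where "S = {g \<in> carrier G. \<theta> (\<phi> g x) (f g) \<noteq> \<one>\<^bsub>B\<^esub>}"
    have one: "\<theta> (\<phi> g x) \<one>\<^bsub>A\<^esub> = \<one>\<^bsub>B\<^esub>" if "g \<in> carrier G" for g
      using Hom [OF that] \<open>group A\<close> B.group_axioms by (simp add: Hom_def hom_one)
    have "S \<subseteq> {g \<in> carrier G. f g \<noteq> \<one>\<^bsub>A\<^esub>}"
      using one by (auto simp: S_def)
    then have finS: "finite S"
      using fin by (rule finite_subset)
    have val': "\<theta>' (\<phi> g x) (f g) = h (\<theta> (\<phi> g x) (f g))" if "g \<in> carrier G" for g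
      using fA [OF that] by (simp add: \<theta>'_def compose_def)
    have S': "{g \<in> carrier G. \<theta>' (\<phi> g x) (f g) \<noteq> \<one>\<^bsub>B'\<^esub>} = S"
    proof -
      have "h b = \<one>\<^bsub>B'\<^esub> \<longleftrightarrow> b = \<one>\<^bsub>B\<^esub>" if "b \<in> carrier B" for b
        using inj_on_eq_iff [OF inj that B.one_closed] h.hom_one by simp
      then show ?thesis
        unfolding S_def using val val' by auto
    qed
    have "\<one>\<^bsub>B'\<^esub> = finprod B' (\<lambda>g. \<theta>' (\<phi> g x) (f g)) S"
      using eq [OF x] finS by (simp add: gfinprod_def S')
    also have "\<dots> = finprod B' (\<lambda>g. h (\<theta> (\<phi> g x) (f g))) S"
      by (rule B'.finprod_cong) (use val val' in \<open>auto simp: S_def\<close>)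
    also have "\<dots> = h (finprod B (\<lambda>g. \<theta> (\<phi> g x) (f g)) S)"
    proof -
      have "finprod B' (\<lambda>g. h (\<theta> (\<phi> g x) (f g))) T = h (finprod B (\<lambda>g. \<theta> (\<phi> g x) (f g)) T)"
        if "finite T" "T \<subseteq> carrier G" for T
        using that by (induction T rule: finite_induct) (auto simp: val Pi_iff subset_iff)
      then show ?thesis
        using finS by (auto simp: S_def)
    qed
    finally have "finprod B (\<lambda>g. \<theta> (\<phi> g x) (f g)) S = \<one>\<^bsub>B\<^esub>"
    proof -
      assume "\<one>\<^bsub>B'\<^esub> = h (finprod B (\<lambda>g. \<theta> (\<phi> g x) (f g)) S)"
      moreover have "finprod B (\<lambda>g. \<theta> (\<phi> g x) (f g)) S \<in> carrier B"
        by (rule B.finprod_closed) (use val in \<open>auto simp: S_def\<close>)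
      ultimately show ?thesis
        using inj_onD [OF inj, of _ "\<one>\<^bsub>B\<^esub>"] h.hom_one by simp
    qed
    then show ?thesis
      using finS by (simp add: gfinprod_def flip: S_def)
  qed
  with f show ?thesis
    unfolding cancellation_wrt_def by blast
qed

end

theory Submission
  imports Defs
begin

text \<open>Absence of cancellation provides \<open>B\<close> and \<open>\<theta>\<close> for which no nontrivial \<open>f\<close> satisfies
  \<open>\<Sum>\<^sub>g \<theta>(gx)(f(g)) = 0\<close> for all \<open>x\<close>. Let \<open>\<psi>\<close> be a faithful action of \<open>G\<close> on \<open>\<Lambda>\<^sup>\<nat>\<close>. The wreath
  product acts on \<open>(\<Sigma> \<times> B \<times> \<Lambda>)\<^sup>\<nat>\<close>: \<open>g\<close> moves the first and third tracks by \<open>\<phi>\<close> and \<open>\<psi>\<close> and fixes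
  the second, while \<open>f\<close> adds \<open>\<Sum>\<^sub>g \<theta>(g\<^sup>-\<^sup>1\<sigma>\<^sup>i(x))(f(g))\<close> to the \<open>i\<close>-th letter of the second track, where
  \<open>x\<close> is the first track. If \<open>(f, g)\<close> acts trivially, the third track forces \<open>g = 1\<close>, and then the
  second track and the choice of \<open>\<theta>\<close> force \<open>f = 0\<close>.\<close>

section \<open>Shift-commuting actions on full shifts\<close>

lemma topspace_full_shift: "topspace (full_shift \<Omega>) = {x. \<forall>i. x i \<in> \<Omega>}"
  by (auto simp: full_shift_def PiE_UNIV_domain)

lemma continuous_map_full_shift:
  "continuous_map X (full_shift \<Omega>) f \<longleftrightarrow> (\<forall>i. continuous_map X (discrete_topology \<Omega>) (\<lambda>x. f x i))"
  unfolding full_shift_def by (rule continuous_map_componentwise_UNIV)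

lemma continuous_map_full_shift_coordinate:
  "continuous_map (full_shift \<Omega>) (discrete_topology \<Omega>) (\<lambda>x. x i)"
  using continuous_map_full_shift [of "full_shift \<Omega>" \<Omega> "\<lambda>x. x"] by simp

lemma continuous_map_compose_discrete:
  assumes "continuous_map X (discrete_topology U) f" and "h \<in> U \<rightarrow> V"
  shows "continuous_map X (discrete_topology V) (\<lambda>x. h (f x))"
  using continuous_map_compose [OF assms(1), of "discrete_topology V" h] assms(2)
  by (simp add: comp_def)

text \<open>A product of two discrete spaces is discrete, so every binary operation on letters is
  continuous. It serves for products of values in \<open>B\<close>.\<close>

lemma continuous_map_compose2_discrete:
  assumes "continuous_map X (discrete_topology U) f" and "continuous_map X (discrete_topology V) g"
    and h: "\<And>u v. u \<in> U \<Longrightarrow> v \<in> V \<Longrightarrow> h u v \<in> W"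
  shows "continuous_map X (discrete_topology W) (\<lambda>x. h (f x) (g x))"
proof -
  have "continuous_map X (discrete_topology (U \<times> V)) (\<lambda>x. (f x, g x))"
    using assms by (simp add: prod_topology_discrete_topology continuous_map_paired)
  moreover have "case_prod h \<in> U \<times> V \<rightarrow> W"
    using h by auto
  ultimately have "continuous_map X (discrete_topology W) (\<lambda>x. case_prod h (f x, g x))"
    by (rule continuous_map_compose_discrete)
  then show ?thesis
    by simp
qed

lemma continuous_map_full_shift_map:
  assumes "e \<in> \<Omega> \<rightarrow> \<Omega>'"
  shows "continuous_map (full_shift \<Omega>) (full_shift \<Omega>') ((\<circ>) e)"
  using continuous_map_compose_discrete [OF continuous_map_full_shift_coordinate assms]
  by (simp add: continuous_map_full_shift comp_def)

lemma shift_comp: "shift (e \<circ> x) = e \<circ> shift x"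
  by (auto simp: shift_def)

lemma shift_in_full_shift:
  "x \<in> topspace (full_shift \<Omega>) \<Longrightarrow> shift x \<in> topspace (full_shift \<Omega>)"
  by (simp add: topspace_full_shift shift_def)

lemma continuous_map_funpow_shift:
  "continuous_map (full_shift \<Omega>) (full_shift \<Omega>) (shift ^^ n)"
proof (induction n)
  case (Suc n)
  have "continuous_map (full_shift \<Omega>) (full_shift \<Omega>) shift"
    by (simp add: continuous_map_full_shift continuous_map_full_shift_coordinate shift_def)
  from continuous_map_compose [OF Suc this] show ?case
    by (simp add: comp_def)
qed simp

section \<open>The automorphism group of a full shift\<close>

lemma subgroup_shift_auts: "subgroup (shift_auts \<Omega>) (BijGroup (topspace (full_shift \<Omega>)))"
proof -
  let ?X = "full_shift \<Omega>"
  interpret BijGroup: group "BijGroup (topspace ?X)"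
    by (rule group_BijGroup)
  show ?thesis
  proof (rule BijGroup.subgroupI)
    show "shift_auts \<Omega> \<subseteq> carrier (BijGroup (topspace ?X))"
      by (auto simp: shift_auts_def BijGroup_def)
    have "homeomorphic_map ?X ?X (\<lambda>x\<in>topspace ?X. x)"
      by (rule homeomorphic_map_eq [of _ _ id]) auto
    then have "(\<lambda>x\<in>topspace ?X. x) \<in> shift_auts \<Omega>"
      by (simp add: shift_auts_def id_Bij shift_in_full_shift)
    then show "shift_auts \<Omega> \<noteq> {}"
      by blast
  next
    fix f assume f: "f \<in> shift_auts \<Omega>"
    then have Bij: "f \<in> Bij (topspace ?X)" and bij: "bij_betw f (topspace ?X) (topspace ?X)"
      and hom: "homeomorphic_map ?X ?X f"
      and comm: "\<And>x. x \<in> topspace ?X \<Longrightarrow> f (shift x) = shift (f x)"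
      by (auto simp: shift_auts_def Bij_def)
    let ?g = "inv_into (topspace ?X) f"
    have g: "?g y \<in> topspace ?X" "f (?g y) = y" if "y \<in> topspace ?X" for y
      using bij that by (auto simp: bij_betw_def inv_into_into f_inv_into_f)
    have gf: "?g (f x) = x" if "x \<in> topspace ?X" for x
      using bij that by (auto simp: bij_betw_def)
    \<comment> \<open>The group inverse is built from \<open>inv_into\<close>, which says nothing
      about continuity. The topological inverse \<open>k\<close> agrees with it on the space and so
      passes its continuity on.\<close>
    obtain k where k: "homeomorphic_maps ?X ?X f k"
      using hom homeomorphic_map_maps by blast
    have "k y = ?g y" if "y \<in> topspace ?X" for y
    proof -
      have "k (f (?g y)) = ?g y"
        using k g(1) [OF that] by (auto simp: homeomorphic_maps_def)
      then show ?thesis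
        by (simp add: g(2) [OF that])
    qed
    moreover have "homeomorphic_map ?X ?X k"
      using k homeomorphic_maps_map by blast
    ultimately have "homeomorphic_map ?X ?X (restrict ?g (topspace ?X))"
      by (auto intro: homeomorphic_map_eq)
    \<comment> \<open>Both sides have the image \<open>shift y\<close> under \<open>f\<close>, since
      \<open>f\<close> commutes with the shift.\<close>
    moreover have "?g (shift y) = shift (?g y)" if "y \<in> topspace ?X" for y
    proof -
      have "?g (f (shift (?g y))) = shift (?g y)"
        using that by (intro gf shift_in_full_shift g)
      then show ?thesis
        by (simp add: comm [OF g(1) [OF that]] g(2) [OF that])
    qed
    ultimately show "inv\<^bsub>BijGroup (topspace ?X)\<^esub> f \<in> shift_auts \<Omega>"
      unfolding inv_BijGroup [OF Bij] using restrict_inv_into_Bij [OF Bij]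
      by (simp add: shift_auts_def shift_in_full_shift)
  next
    fix f g assume f: "f \<in> shift_auts \<Omega>" and g: "g \<in> shift_auts \<Omega>"
    then have Bij: "f \<in> Bij (topspace ?X)" "g \<in> Bij (topspace ?X)"
      by (auto simp: shift_auts_def)
    have "homeomorphic_map ?X ?X (f \<circ> g)"
      using f g by (auto simp: shift_auts_def intro: homeomorphic_map_compose)
    then have "homeomorphic_map ?X ?X (compose (topspace ?X) f g)"
      by (rule homeomorphic_map_eq) (simp add: compose_def)
    moreover have "g x \<in> topspace ?X" if "x \<in> topspace ?X" for x
      using Bij_imp_funcset [OF Bij(2)] that by auto
    ultimately show "f \<otimes>\<^bsub>BijGroup (topspace ?X)\<^esub> g \<in> shift_auts \<Omega>"
      using f g Bij compose_Bij [OF Bij]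
      by (auto simp: BijGroup_def shift_auts_def compose_def shift_in_full_shift)
  qed
qed

lemma group_shift_Aut: "group (shift_Aut \<Omega>)"
  unfolding shift_Aut_def
  by (rule subgroup.subgroup_is_group [OF subgroup_shift_auts group_BijGroup])

lemma carrier_shift_Aut [simp]: "carrier (shift_Aut \<Omega>) = shift_auts \<Omega>"
  by (simp add: shift_Aut_def)

lemma one_shift_Aut: "\<one>\<^bsub>shift_Aut \<Omega>\<^esub> = (\<lambda>x\<in>topspace (full_shift \<Omega>). x)"
  by (simp add: shift_Aut_def BijGroup_def)

lemma mult_shift_Aut:
  assumes "f \<in> shift_auts \<Omega>" "g \<in> shift_auts \<Omega>"
  shows "f \<otimes>\<^bsub>shift_Aut \<Omega>\<^esub> g = compose (topspace (full_shift \<Omega>)) f g"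
  using assms by (simp add: shift_Aut_def BijGroup_def shift_auts_def)

section \<open>Group actions by shift-commuting maps\<close>

text \<open>Here \<open>\<alpha> g\<close> need not be extensional and the letters may have any
  type, so actions on several tracks can be written by plain formulas. Extensionality is restored
  only on passing to \<open>shift_Aut\<close>.\<close>

locale shift_action = group G for G :: "('g, 'n) monoid_scheme" (structure) +
  fixes \<Omega> :: "'t set" and \<alpha> :: "'g \<Rightarrow> (nat \<Rightarrow> 't) \<Rightarrow> nat \<Rightarrow> 't"
  assumes continuous: "g \<in> carrier G \<Longrightarrow> continuous_map (full_shift \<Omega>) (full_shift \<Omega>) (\<alpha> g)"
    and commute: "\<lbrakk>g \<in> carrier G; x \<in> topspace (full_shift \<Omega>)\<rbrakk> \<Longrightarrow> \<alpha> g (shift x) = shift (\<alpha> g x)"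
    and act_one: "x \<in> topspace (full_shift \<Omega>) \<Longrightarrow> \<alpha> \<one> x = x"
    and act_mult: "\<lbrakk>g \<in> carrier G; h \<in> carrier G; x \<in> topspace (full_shift \<Omega>)\<rbrakk>
      \<Longrightarrow> \<alpha> (g \<otimes> h) x = \<alpha> g (\<alpha> h x)"
begin

lemma act_closed:
  "\<lbrakk>g \<in> carrier G; x \<in> topspace (full_shift \<Omega>)\<rbrakk> \<Longrightarrow> \<alpha> g x \<in> topspace (full_shift \<Omega>)"
  using continuous by (auto simp: continuous_map_def)

lemma commute_funpow:
  assumes "g \<in> carrier G" "x \<in> topspace (full_shift \<Omega>)"
  shows "\<alpha> g ((shift ^^ n) x) = (shift ^^ n) (\<alpha> g x)"
  using assms
  by (induction n arbitrary: x) (simp_all add: funpow_Suc_right commute shift_in_full_shift del: funpow.simps(2))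

text \<open>The inverse of \<open>\<alpha> g\<close> is \<open>\<alpha> (inv g)\<close>, which is
  continuous by the same axiom. Restriction changes nothing on the space.\<close>

lemma restrict_mem_shift_auts:
  assumes g: "g \<in> carrier G"
  shows "restrict (\<alpha> g) (topspace (full_shift \<Omega>)) \<in> shift_auts \<Omega>"
proof -
  let ?X = "full_shift \<Omega>"
  have inv: "\<alpha> (inv g) (\<alpha> g x) = x" "\<alpha> g (\<alpha> (inv g) x) = x" if "x \<in> topspace ?X" for x
    using act_mult [of "inv g" g x] act_mult [of g "inv g" x] g that by (auto simp: act_one)
  have "homeomorphic_maps ?X ?X (\<alpha> g) (\<alpha> (inv g))"
    using g by (simp add: homeomorphic_maps_def continuous inv)
  then have "homeomorphic_map ?X ?X (\<alpha> g)"
    by (rule homeomorphic_maps_imp_map)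
  then have "homeomorphic_map ?X ?X (restrict (\<alpha> g) (topspace ?X))"
    by (rule homeomorphic_map_eq) simp
  moreover have "bij_betw (restrict (\<alpha> g) (topspace ?X)) (topspace ?X) (topspace ?X)"
    by (rule bij_betwI [of _ _ _ "\<alpha> (inv g)"]) (use g in \<open>auto simp: inv act_closed\<close>)
  ultimately show ?thesis
    using g by (simp add: shift_auts_def Bij_def commute shift_in_full_shift)
qed

lemma restrict_hom_shift_Aut:
  "(\<lambda>g. restrict (\<alpha> g) (topspace (full_shift \<Omega>))) \<in> hom G (shift_Aut \<Omega>)"
proof (rule homI)
  fix g h assume "g \<in> carrier G" "h \<in> carrier G"
  then show "restrict (\<alpha> (g \<otimes> h)) (topspace (full_shift \<Omega>)) =
      restrict (\<alpha> g) (topspace (full_shift \<Omega>)) \<otimes>\<^bsub>shift_Aut \<Omega>\<^esub> restrict (\<alpha> h) (topspace (full_shift \<Omega>))"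
    by (auto simp: mult_shift_Aut restrict_mem_shift_auts compose_def act_mult act_closed)
qed (simp add: restrict_mem_shift_auts)

end

lemma hom_shift_Aut_imp_shift_action:
  fixes G :: "('g, 'n) monoid_scheme"
  assumes "group G" and \<phi>: "\<phi> \<in> hom G (shift_Aut \<Omega>)"
  shows "shift_action G \<Omega> \<phi>"
proof -
  interpret G: group G by fact
  have aut: "\<phi> g \<in> shift_auts \<Omega>" if "g \<in> carrier G" for g
    using hom_in_carrier [OF \<phi> that] by simp
  show ?thesis
  proof
    show "continuous_map (full_shift \<Omega>) (full_shift \<Omega>) (\<phi> g)" if "g \<in> carrier G" for g
      using aut [OF that] by (auto simp: shift_auts_def homeomorphic_imp_continuous_map)
    show "\<phi> g (shift x) = shift (\<phi> g x)"
      if "g \<in> carrier G" "x \<in> topspace (full_shift \<Omega>)" for g x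
      using aut that by (auto simp: shift_auts_def)
    show "\<phi> \<one>\<^bsub>G\<^esub> x = x" if "x \<in> topspace (full_shift \<Omega>)" for x
      using hom_one [OF \<phi> \<open>group G\<close> group_shift_Aut] that by (simp add: one_shift_Aut)
    show "\<phi> (g \<otimes>\<^bsub>G\<^esub> h) x = \<phi> g (\<phi> h x)"
      if "g \<in> carrier G" "h \<in> carrier G" "x \<in> topspace (full_shift \<Omega>)" for g h x
      using hom_mult [OF \<phi> that(1,2)] aut that by (simp add: mult_shift_Aut compose_def)
  qed
qed

text \<open>Membership in the class asks for an alphabet of natural numbers. The action is therefore
  carried over by renaming letters; faithfulness then makes the induced homomorphism to
  \<open>shift_Aut N\<close> injective, and its image is the required subgroup.\<close>

lemma faithful_shift_action_imp_in_class_infinity: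
  assumes "shift_action G \<Omega> \<alpha>" and "finite \<Omega>" and "card \<Omega> \<ge> 2"
    and faithful: "\<And>g. \<lbrakk>g \<in> carrier G; \<And>x. x \<in> topspace (full_shift \<Omega>) \<Longrightarrow> \<alpha> g x = x\<rbrakk> \<Longrightarrow> g = \<one>\<^bsub>G\<^esub>"
  shows "in_class_infinity G"
proof -
  interpret shift_action G \<Omega> \<alpha> by fact
  obtain e :: "_ \<Rightarrow> nat" where inj: "inj_on e \<Omega>"
    using \<open>finite \<Omega>\<close> finite_imp_inj_to_nat_seg by blast
  define N where "N = e ` \<Omega>"
  define d where "d = inv_into \<Omega> e"
  have e: "e \<in> \<Omega> \<rightarrow> N" and d: "d \<in> N \<rightarrow> \<Omega>"
    by (auto simp: N_def d_def inv_into_into)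
  have de: "d (e a) = a" if "a \<in> \<Omega>" for a
    using inj that by (simp add: d_def)
  have ed: "e (d b) = b" if "b \<in> N" for b
    using that by (simp add: N_def d_def f_inv_into_f)
  have dx: "d \<circ> y \<in> topspace (full_shift \<Omega>)" and edx: "e \<circ> (d \<circ> y) = y"
    if "y \<in> topspace (full_shift N)" for y
    using that d ed by (auto simp: topspace_full_shift fun_eq_iff)
  have ex: "e \<circ> x \<in> topspace (full_shift N)" and dex: "d \<circ> (e \<circ> x) = x"
    if "x \<in> topspace (full_shift \<Omega>)" for x
    using that e de by (auto simp: topspace_full_shift fun_eq_iff)
  \<comment> \<open>Conjugation by the renaming \<open>e\<close>, with inverse \<open>d\<close>.
    Renaming acts on each coordinate separately and hence commutes with the shift.\<close>
  define \<beta> where "\<beta> = (\<lambda>g y. e \<circ> \<alpha> g (d \<circ> y))"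
  interpret \<beta>: shift_action G N \<beta>
  proof
    show "continuous_map (full_shift N) (full_shift N) (\<beta> g)" if "g \<in> carrier G" for g
      using continuous_map_compose [OF continuous_map_compose [OF
            continuous_map_full_shift_map [OF d] continuous [OF that]]
          continuous_map_full_shift_map [OF e]]
      by (simp add: \<beta>_def o_def)
  qed (simp_all add: \<beta>_def commute dx edx act_one act_mult dex act_closed flip: shift_comp)
  define \<Phi> where "\<Phi> = (\<lambda>g. restrict (\<beta> g) (topspace (full_shift N)))"
  interpret \<Phi>: group_hom G "shift_Aut N" \<Phi>
    using \<beta>.restrict_hom_shift_Aut group_shift_Aut
    by (simp add: group_hom_def group_hom_axioms_def is_group \<Phi>_def)
  have "g = \<one>\<^bsub>G\<^esub>" if g: "g \<in> carrier G" and one: "\<Phi> g = \<one>\<^bsub>shift_Aut N\<^esub>" for g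
  proof (rule faithful [OF g])
    fix x assume x: "x \<in> topspace (full_shift \<Omega>)"
    have "\<beta> g (e \<circ> x) = e \<circ> x"
      using fun_cong [OF one, of "e \<circ> x"] ex [OF x] by (simp add: \<Phi>_def one_shift_Aut)
    then have "d \<circ> (e \<circ> \<alpha> g x) = d \<circ> (e \<circ> x)"
      by (simp add: \<beta>_def dex x)
    then show "\<alpha> g x = x"
      using x g by (simp add: dex act_closed)
  qed
  then have "inj_on \<Phi> (carrier G)"
    using \<Phi>.inj_on_one_iff by blast
  then have "\<Phi> \<in> iso G ((shift_Aut N)\<lparr>carrier := \<Phi> ` carrier G\<rparr>)"
    by (auto simp: iso_def bij_betw_def hom_def)
  then have "G \<cong> (shift_Aut N)\<lparr>carrier := \<Phi> ` carrier G\<rparr>"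
    by (auto simp: is_iso_def)
  moreover have "finite N" "card N = card \<Omega>"
    using \<open>finite \<Omega>\<close> inj by (auto simp: N_def card_image)
  ultimately have "in_class (card \<Omega>) G"
    unfolding in_class_def using \<Phi>.img_is_subgroup is_group \<open>card \<Omega> \<ge> 2\<close> by blast
  then show ?thesis
    unfolding in_class_infinity_def by blast
qed

section \<open>Translations and the wreath product\<close>

text \<open>This is the left regular action of the group on the direct sum, which the multiplication
  of \<open>wreath\<close> contains inline.\<close>

definition translate :: "('g, 'n) monoid_scheme \<Rightarrow> 'g \<Rightarrow> ('g \<Rightarrow> 'a) \<Rightarrow> 'g \<Rightarrow> 'a" where
  "translate G g f = (\<lambda>h\<in>carrier G. f (inv\<^bsub>G\<^esub> g \<otimes>\<^bsub>G\<^esub> h))"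

lemma wreath_simps:
  "carrier (wreath A G) = carrier (sum_group (carrier G) (\<lambda>_. A)) \<times> carrier G"
  "(f, g) \<otimes>\<^bsub>wreath A G\<^esub> (f', g') =
     (f \<otimes>\<^bsub>sum_group (carrier G) (\<lambda>_. A)\<^esub> translate G g f', g \<otimes>\<^bsub>G\<^esub> g')"
  "\<one>\<^bsub>wreath A G\<^esub> = (\<one>\<^bsub>sum_group (carrier G) (\<lambda>_. A)\<^esub>, \<one>\<^bsub>G\<^esub>)"
  by (simp_all add: wreath_def translate_def)

context group
begin

text \<open>The support of the translate lies in the left translate by \<open>g\<close> of the
  support of \<open>f\<close>, so it stays finite.\<close>

lemma translate_closed:
  assumes "group A" and f: "f \<in> carrier (sum_group (carrier G) (\<lambda>_. A))" and g: "g \<in> carrier G"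
  shows "translate G g f \<in> carrier (sum_group (carrier G) (\<lambda>_. A))"
proof -
  have fin: "finite {h \<in> carrier G. f h \<noteq> \<one>\<^bsub>A\<^esub>}"
    using f \<open>group A\<close> by (simp add: carrier_sum_group)
  have "{h \<in> carrier G. translate G g f h \<noteq> \<one>\<^bsub>A\<^esub>}
      \<subseteq> (\<lambda>h. g \<otimes> h) ` {h \<in> carrier G. f h \<noteq> \<one>\<^bsub>A\<^esub>}"
  proof
    fix h assume "h \<in> {h \<in> carrier G. translate G g f h \<noteq> \<one>\<^bsub>A\<^esub>}"
    then have "h = g \<otimes> (inv g \<otimes> h)" "inv g \<otimes> h \<in> {h \<in> carrier G. f h \<noteq> \<one>\<^bsub>A\<^esub>}"
      using g by (auto simp: translate_def simp flip: m_assoc)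
    then show "h \<in> (\<lambda>h. g \<otimes> h) ` {h \<in> carrier G. f h \<noteq> \<one>\<^bsub>A\<^esub>}"
      by (rule image_eqI)
  qed
  then have "finite {h \<in> carrier G. translate G g f h \<noteq> \<one>\<^bsub>A\<^esub>}"
    using fin by (rule finite_surj [rotated])
  then show ?thesis
    using f g \<open>group A\<close> by (auto simp: carrier_sum_group translate_def)
qed

lemma translate_mult_sum_group:
  assumes "g \<in> carrier G"
  shows "translate G g (f \<otimes>\<^bsub>sum_group (carrier G) (\<lambda>_. A)\<^esub> f') =
    translate G g f \<otimes>\<^bsub>sum_group (carrier G) (\<lambda>_. A)\<^esub> translate G g f'"
  using assms by (auto simp: translate_def)

lemma translate_translate:
  assumes "g \<in> carrier G" "h \<in> carrier G"
  shows "translate G g (translate G h f) = translate G (g \<otimes> h) f"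
  using assms by (auto simp: translate_def inv_mult_group m_assoc)

lemma translate_one:
  assumes "group A" and "f \<in> carrier (sum_group (carrier G) (\<lambda>_. A))"
  shows "translate G \<one> f = f"
  using assms by (auto simp: translate_def carrier_sum_group PiE_iff extensional_def)

lemma translate_one_sum_group:
  assumes "g \<in> carrier G"
  shows "translate G g \<one>\<^bsub>sum_group (carrier G) (\<lambda>_. A)\<^esub> = \<one>\<^bsub>sum_group (carrier G) (\<lambda>_. A)\<^esub>"
  using assms by (auto simp: translate_def)

text \<open>The group laws reduce to those of the direct sum and of \<open>G\<close>, because
  translation is an action by endomorphisms of the direct sum.\<close>

lemma group_wreath:
  assumes "group A"
  shows "group (wreath A G)"
proof -
  let ?S = "sum_group (carrier G) (\<lambda>_. A)"
  interpret S: group ?S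
    using assms by simp
  note [simp del] = mult_sum_group one_sum_group
  note [simp] = wreath_simps translate_closed [OF assms]
  show ?thesis
  proof (rule groupI)
    fix x assume "x \<in> carrier (wreath A G)"
    then obtain f g where x: "x = (f, g)" and f: "f \<in> carrier ?S" and g: "g \<in> carrier G"
      by auto
    \<comment> \<open>A left inverse of \<open>(f, g)\<close>: in the product both first components
      are translated by \<open>inv g\<close>, so they merge into the translate of the
      identity.\<close>
    have "(translate G (inv g) (inv\<^bsub>?S\<^esub> f), inv g) \<otimes>\<^bsub>wreath A G\<^esub> x = \<one>\<^bsub>wreath A G\<^esub>"
      using f g by (simp add: x translate_one_sum_group flip: translate_mult_sum_group)
    moreover have "(translate G (inv g) (inv\<^bsub>?S\<^esub> f), inv g) \<in> carrier (wreath A G)"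
      using f g by (simp del: inv_sum_group)
    ultimately show "\<exists>y\<in>carrier (wreath A G). y \<otimes>\<^bsub>wreath A G\<^esub> x = \<one>\<^bsub>wreath A G\<^esub>"
      by blast
  qed (auto simp: translate_mult_sum_group translate_translate translate_one [OF assms]
      S.m_assoc m_assoc)
qed

end

section \<open>Reindexing products over the support\<close>

context comm_monoid
begin

lemma gfinprod_eqI:
  assumes "u \<in> I \<rightarrow> carrier G" and "\<And>i. i \<in> I \<Longrightarrow> u i = v i"
  shows "gfinprod G u I = gfinprod G v I"
  by (rule gfinprod_cong) (use assms in \<open>auto simp: simp_implies_def\<close>)

text \<open>The bijection carries one support onto the other, so both are finite or both infinite.
  In the infinite case both products are one by convention.\<close>

lemma gfinprod_reindex_bij:
  assumes k: "bij_betw k I J" and u: "u \<in> J \<rightarrow> carrier G"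
  shows "gfinprod G (\<lambda>i. u (k i)) I = gfinprod G u J"
proof -
  have J: "J = k ` I" and inj: "inj_on k I"
    using k by (auto simp: bij_betw_def)
  have eq: "{j \<in> J. u j \<noteq> \<one>} = k ` {i \<in> I. u (k i) \<noteq> \<one>}"
    by (auto simp: J)
  have inj': "inj_on k {i \<in> I. u (k i) \<noteq> \<one>}"
    using inj by (rule inj_on_subset) auto
  have "finprod G u (k ` {i \<in> I. u (k i) \<noteq> \<one>}) = finprod G (\<lambda>i. u (k i)) {i \<in> I. u (k i) \<noteq> \<one>}"
    by (rule finprod_reindex) (use u inj' in \<open>auto simp: J\<close>)
  then show ?thesis
    by (simp add: gfinprod_def eq finite_image_iff [OF inj'])
qed

end

section \<open>The cocycle attached to a family of homomorphisms\<close>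

locale hom_valued_shift_action =
  shift_action G \<Sigma> \<phi> + A: comm_group A + B: comm_group B
  for G :: "('g, 'n) monoid_scheme" (structure) and \<Sigma> :: "'s set" and \<phi>
    and A :: "('a, 'm) monoid_scheme" and B :: "('b, 'k) monoid_scheme" +
  fixes \<theta> :: "(nat \<Rightarrow> 's) \<Rightarrow> 'a \<Rightarrow> 'b"
  assumes continuous_\<theta>: "continuous_map (full_shift \<Sigma>) (discrete_topology (Hom A B)) \<theta>"
begin

abbreviation S where "S \<equiv> sum_group (carrier G) (\<lambda>_. A)"

text \<open>The inverse makes \<open>cocycle\<close> equivariant for left translations.\<close>

definition cocycle :: "('g \<Rightarrow> 'a) \<Rightarrow> (nat \<Rightarrow> 's) \<Rightarrow> 'b" where
  "cocycle f x = gfinprod B (\<lambda>g. \<theta> (\<phi> (inv g) x) (f g)) (carrier G)"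

lemma \<theta>_hom: "x \<in> topspace (full_shift \<Sigma>) \<Longrightarrow> \<theta> x \<in> hom A B"
  using continuous_\<theta> by (auto simp: continuous_map_def Hom_def)

lemma carrier_S: "carrier S = {f \<in> carrier G \<rightarrow>\<^sub>E carrier A. finite {g \<in> carrier G. f g \<noteq> \<one>\<^bsub>A\<^esub>}}"
  by (simp add: carrier_sum_group)

text \<open>For fixed \<open>x\<close> the cocycle is the map out of the direct sum determined by
  the homomorphisms \<open>\<theta> (\<phi> (inv g) x)\<close> on its summands.\<close>

lemma cocycle_hom:
  assumes x: "x \<in> topspace (full_shift \<Sigma>)"
  shows "(\<lambda>f. cocycle f x) \<in> hom S B"
  unfolding cocycle_def
  by (rule B.hom_group_sum) (simp_all add: \<theta>_hom act_closed x)

lemma term_closed: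
  assumes "f \<in> carrier S" "x \<in> topspace (full_shift \<Sigma>)" "g \<in> carrier G"
  shows "\<theta> (\<phi> (inv g) x) (f g) \<in> carrier B"
  using hom_in_carrier [OF \<theta>_hom [OF act_closed]] assms by (auto simp: carrier_S PiE_iff)

lemma cocycle_closed:
  "\<lbrakk>f \<in> carrier S; x \<in> topspace (full_shift \<Sigma>)\<rbrakk> \<Longrightarrow> cocycle f x \<in> carrier B"
  using hom_in_carrier [OF cocycle_hom] by simp

lemma cocycle_one: "x \<in> topspace (full_shift \<Sigma>) \<Longrightarrow> cocycle \<one>\<^bsub>S\<^esub> x = \<one>\<^bsub>B\<^esub>"
  using hom_one [OF cocycle_hom] B.is_group by simp

lemma cocycle_mult:
  "\<lbrakk>f \<in> carrier S; f' \<in> carrier S; x \<in> topspace (full_shift \<Sigma>)\<rbrakk>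
    \<Longrightarrow> cocycle (f \<otimes>\<^bsub>S\<^esub> f') x = cocycle f x \<otimes>\<^bsub>B\<^esub> cocycle f' x"
  using hom_mult [OF cocycle_hom] by simp

text \<open>Substituting \<open>inv h \<otimes> g\<close> for \<open>g\<close> works because its
  inverse sends \<open>x\<close> to the point to which \<open>inv g\<close> sends
  \<open>\<phi> h x\<close>. This equivariance matches the twist in the wreath product
  multiplication.\<close>

lemma cocycle_translate:
  assumes f: "f \<in> carrier S" and h: "h \<in> carrier G" and x: "x \<in> topspace (full_shift \<Sigma>)"
  shows "cocycle (translate G h f) (\<phi> h x) = cocycle f x"
proof -
  have bij: "bij_betw (\<lambda>g. inv h \<otimes> g) (carrier G) (carrier G)"
    by (rule bij_betwI [of _ _ _ "\<lambda>g. h \<otimes> g"]) (use h in \<open>auto simp flip: m_assoc\<close>)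
  have "cocycle (translate G h f) (\<phi> h x)
      = gfinprod B (\<lambda>g. \<theta> (\<phi> (inv (inv h \<otimes> g)) x) (f (inv h \<otimes> g))) (carrier G)"
    unfolding cocycle_def
  proof (rule B.gfinprod_eqI)
    show "\<theta> (\<phi> (inv g) (\<phi> h x)) (translate G h f g) = \<theta> (\<phi> (inv (inv h \<otimes> g)) x) (f (inv h \<otimes> g))"
      if "g \<in> carrier G" for g
      using that h x by (simp add: translate_def inv_mult_group act_mult)
  qed (use term_closed [OF translate_closed [OF A.is_group f h] act_closed [OF h x]] in auto)
  also have "\<dots> = cocycle f x"
    unfolding cocycle_def
    by (rule B.gfinprod_reindex_bij [OF bij, of "\<lambda>g. \<theta> (\<phi> (inv g) x) (f g)"])
      (use term_closed [OF f x] in auto)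
  finally show ?thesis .
qed

text \<open>The product runs over the finite support of \<open>f\<close>, which does not depend on
  \<open>x\<close>, and each factor is a continuous function of \<open>x\<close> with discrete
  values.\<close>

lemma continuous_cocycle:
  assumes f: "f \<in> carrier S"
  shows "continuous_map (full_shift \<Sigma>) (discrete_topology (carrier B)) (cocycle f)"
proof -
  let ?t = "\<lambda>x g. \<theta> (\<phi> (inv g) x) (f g)"
  have cont: "continuous_map (full_shift \<Sigma>) (discrete_topology (carrier B)) (\<lambda>x. ?t x g)"
    if g: "g \<in> carrier G" for g
  proof (rule continuous_map_compose_discrete [where h = "\<lambda>u. u (f g)"])
    show "continuous_map (full_shift \<Sigma>) (discrete_topology (Hom A B)) (\<lambda>x. \<theta> (\<phi> (inv g) x))"
      using continuous_map_compose [OF continuous [OF inv_closed [OF g]] continuous_\<theta>]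
      by (simp add: comp_def)
    show "(\<lambda>u. u (f g)) \<in> Hom A B \<rightarrow> carrier B"
      using f g by (auto simp: Hom_def hom_def carrier_S)
  qed
  have fin: "continuous_map (full_shift \<Sigma>) (discrete_topology (carrier B)) (\<lambda>x. finprod B (?t x) T)"
    if "finite T" "T \<subseteq> carrier G" for T
    using that
  proof (induction T rule: finite_induct)
    case (insert g T)
    have "continuous_map (full_shift \<Sigma>) (discrete_topology (carrier B))
        (\<lambda>x. ?t x g \<otimes>\<^bsub>B\<^esub> finprod B (?t x) T)"
      by (rule continuous_map_compose2_discrete [OF cont]) (use insert in auto)
    then show ?case
    proof (rule continuous_map_eq)
      fix x assume x: "x \<in> topspace (full_shift \<Sigma>)"
      have "?t x \<in> T \<rightarrow> carrier B" "?t x g \<in> carrier B"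
        using term_closed [OF f x] insert.prems by auto
      then show "?t x g \<otimes>\<^bsub>B\<^esub> finprod B (?t x) T = finprod B (?t x) (insert g T)"
        using insert.hyps by simp
    qed
  qed simp
  \<comment> \<open>The product in \<open>cocycle\<close> runs over the support of the factors,
    which varies with \<open>x\<close>. That support lies inside \<open>T\<close>, since
    homomorphisms send one to one, and the additional factors are trivial.\<close>
  define T where "T = {g \<in> carrier G. f g \<noteq> \<one>\<^bsub>A\<^esub>}"
  have T: "finite T" "T \<subseteq> carrier G"
    using f by (auto simp: T_def carrier_S)
  from fin [OF this] show ?thesis
  proof (rule continuous_map_eq)
    fix x assume x: "x \<in> topspace (full_shift \<Sigma>)"
    have "?t x g = \<one>\<^bsub>B\<^esub>" if "g \<in> carrier G - T" for g
      using that hom_one [OF \<theta>_hom [OF act_closed] A.is_group B.is_group] x by (simp add: T_def)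
    then have "gfinprod B (?t x) T = cocycle f x"
      unfolding cocycle_def
      by (intro B.gfinprod_mono_neutral_cong_left) (use term_closed [OF f x] T in auto)
    then show "finprod B (?t x) T = cocycle f x"
      using T term_closed [OF f x] by (subst (asm) B.gfinprod_eq_finprod) auto
  qed
qed

text \<open>Cancellation is phrased with the points \<open>\<phi> g x\<close>, the cocycle with
  \<open>\<phi> (inv g) x\<close>. Precomposing \<open>f\<close> with inversion turns a vanishing
  cocycle into a cancellation relation, and keeps the support finite.\<close>

lemma cocycle_trivial_imp_one:
  assumes no_canc: "\<not> cancellation_wrt A G (full_shift \<Sigma>) \<phi> \<theta> B"
    and f: "f \<in> carrier S"
    and triv: "\<And>x. x \<in> topspace (full_shift \<Sigma>) \<Longrightarrow> cocycle f x = \<one>\<^bsub>B\<^esub>"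
  shows "f = \<one>\<^bsub>S\<^esub>"
proof -
  define f' where "f' = (\<lambda>g\<in>carrier G. f (inv g))"
  have bij: "bij_betw (\<lambda>g. inv g) (carrier G) (carrier G)"
    by (rule bij_betwI [of _ _ _ "\<lambda>g. inv g"]) auto
  have "{g \<in> carrier G. f' g \<noteq> \<one>\<^bsub>A\<^esub>} \<subseteq> (\<lambda>g. inv g) ` {g \<in> carrier G. f g \<noteq> \<one>\<^bsub>A\<^esub>}"
  proof
    fix g assume "g \<in> {g \<in> carrier G. f' g \<noteq> \<one>\<^bsub>A\<^esub>}"
    then have "g = inv (inv g)" "inv g \<in> {g \<in> carrier G. f g \<noteq> \<one>\<^bsub>A\<^esub>}"
      by (auto simp: f'_def)
    then show "g \<in> (\<lambda>g. inv g) ` {g \<in> carrier G. f g \<noteq> \<one>\<^bsub>A\<^esub>}"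
      by (rule image_eqI)
  qed
  then have "finite {g \<in> carrier G. f' g \<noteq> \<one>\<^bsub>A\<^esub>}"
    using f by (auto simp: carrier_S intro: finite_surj)
  then have f': "f' \<in> carrier S"
    using f by (auto simp: carrier_S f'_def)
  have "gfinprod B (\<lambda>g. \<theta> (\<phi> g x) (f' g)) (carrier G) = \<one>\<^bsub>B\<^esub>"
    if x: "x \<in> topspace (full_shift \<Sigma>)" for x
  proof -
    have "gfinprod B (\<lambda>g. \<theta> (\<phi> g x) (f' g)) (carrier G) =
        gfinprod B (\<lambda>g. \<theta> (\<phi> (inv (inv g)) x) (f (inv g))) (carrier G)"
      using hom_in_carrier [OF \<theta>_hom [OF act_closed [OF _ x]]] f'
      by (intro B.gfinprod_eqI) (auto simp: carrier_S, simp add: f'_def)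
    also have "\<dots> = cocycle f x"
      unfolding cocycle_def
      by (rule B.gfinprod_reindex_bij [OF bij, of "\<lambda>g. \<theta> (\<phi> (inv g) x) (f g)"])
        (use term_closed [OF f x] in auto)
    finally show ?thesis
      using triv [OF x] by simp
  qed
  with no_canc f' have "f' = \<one>\<^bsub>S\<^esub>"
    unfolding cancellation_wrt_def by blast
  then have "f (inv g) = \<one>\<^bsub>A\<^esub>" if "g \<in> carrier G" for g
    using that by (metis f'_def one_sum_group restrict_apply')
  then have "f g = \<one>\<^bsub>A\<^esub>" if "g \<in> carrier G" for g
    using that by (metis inv_closed inv_inv)
  then show ?thesis
    using f by (auto simp: carrier_S PiE_iff extensional_def)
qed

end

section \<open>The wreath product action\<close>

locale wreath_shift_action =
  hom_valued_shift_action G \<Sigma> \<phi> A B \<theta> + \<psi>: shift_action G \<Lambda> \<psi>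
  for G :: "('g, 'n) monoid_scheme" (structure) and \<Sigma> :: "'s set" and \<phi>
    and A :: "('a, 'm) monoid_scheme" and B :: "('b, 'k) monoid_scheme" and \<theta>
    and \<Lambda> :: "'l set" and \<psi>
begin

text \<open>The element \<open>(f, g)\<close> is \<open>g\<close> followed by \<open>f\<close>, so
  the cocycle is evaluated at the first track already moved by \<open>g\<close>. The power of the
  shift makes the same local rule apply at every coordinate.\<close>

definition wreath_act ::
  "('g \<Rightarrow> 'a) \<times> 'g \<Rightarrow> (nat \<Rightarrow> 's \<times> 'b \<times> 'l) \<Rightarrow> nat \<Rightarrow> 's \<times> 'b \<times> 'l" where
  "wreath_act = (\<lambda>(f, g) w i.
     (\<phi> g (fst \<circ> w) i,
      fst (snd (w i)) \<otimes>\<^bsub>B\<^esub> cocycle f ((shift ^^ i) (\<phi> g (fst \<circ> w))),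
      \<psi> g (snd \<circ> snd \<circ> w) i))"

abbreviation alphabet where "alphabet \<equiv> \<Sigma> \<times> carrier B \<times> \<Lambda>"

lemma wreath_act_components:
  "fst \<circ> wreath_act (f, g) w = \<phi> g (fst \<circ> w)"
  "snd \<circ> snd \<circ> wreath_act (f, g) w = \<psi> g (snd \<circ> snd \<circ> w)"
  by (auto simp: wreath_act_def)

lemma components:
  assumes "w \<in> topspace (full_shift alphabet)"
  shows "fst \<circ> w \<in> topspace (full_shift \<Sigma>)" and "fst (snd (w i)) \<in> carrier B"
    and "snd \<circ> snd \<circ> w \<in> topspace (full_shift \<Lambda>)"
  using assms by (auto simp: topspace_full_shift mem_Times_iff)

lemma funpow_shift_closed:
  "x \<in> topspace (full_shift \<Sigma>) \<Longrightarrow> (shift ^^ i) x \<in> topspace (full_shift \<Sigma>)"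
  using continuous_map_funpow_shift by (auto simp: continuous_map_def)

lemma continuous_wreath_act:
  assumes f: "f \<in> carrier S" and g: "g \<in> carrier G"
  shows "continuous_map (full_shift alphabet) (full_shift alphabet) (wreath_act (f, g))"
  unfolding continuous_map_full_shift
proof
  fix i
  let ?X = "full_shift alphabet"
  have fst: "continuous_map ?X (full_shift \<Sigma>) (\<lambda>w. \<phi> g (fst \<circ> w))"
    using continuous_map_compose [OF continuous_map_full_shift_map [of fst alphabet] continuous [OF g]]
    by (force simp: o_def)
  have coord: "continuous_map (full_shift \<Omega>) (discrete_topology \<Omega>) (\<lambda>x. x i)" for \<Omega> :: "'x set"
    by (rule continuous_map_full_shift_coordinate)
  have 1: "continuous_map ?X (discrete_topology \<Sigma>) (\<lambda>w. \<phi> g (fst \<circ> w) i)"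
    using continuous_map_compose [OF fst coord] by (simp add: o_def)
  have "continuous_map ?X (full_shift \<Lambda>) (\<lambda>w. \<psi> g (snd \<circ> snd \<circ> w))"
    using continuous_map_compose [OF continuous_map_full_shift_map [of "snd \<circ> snd" alphabet]
        \<psi>.continuous [OF g]]
    by (force simp: o_def)
  from continuous_map_compose [OF this coord]
  have 3: "continuous_map ?X (discrete_topology \<Lambda>) (\<lambda>w. \<psi> g (snd \<circ> snd \<circ> w) i)"
    by (simp add: o_def)
  have "continuous_map ?X (discrete_topology (carrier B))
      (\<lambda>w. cocycle f ((shift ^^ i) (\<phi> g (fst \<circ> w))))"
    using continuous_map_compose [OF continuous_map_compose [OF fst continuous_map_funpow_shift]
        continuous_cocycle [OF f]]
    by (simp add: o_def)
  moreover have "continuous_map ?X (discrete_topology (carrier B)) (\<lambda>w. fst (snd (w i)))"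
    by (rule continuous_map_compose_discrete [OF coord]) auto
  ultimately have 2: "continuous_map ?X (discrete_topology (carrier B))
      (\<lambda>w. fst (snd (w i)) \<otimes>\<^bsub>B\<^esub> cocycle f ((shift ^^ i) (\<phi> g (fst \<circ> w))))"
    by (intro continuous_map_compose2_discrete [where h = "(\<otimes>\<^bsub>B\<^esub>)"]) auto
  show "continuous_map ?X (discrete_topology alphabet) (\<lambda>w. wreath_act (f, g) w i)"
    using 1 2 3 by (simp add: wreath_act_def prod_topology_discrete_topology continuous_map_paired)
qed

text \<open>The first and third tracks inherit the action laws from \<open>\<phi>\<close> and
  \<open>\<psi>\<close>. For multiplicativity on the second track, additivity of the cocycle in
  \<open>f\<close> combines with its equivariance.\<close>

lemma shift_action_wreath: "shift_action (wreath A G) alphabet wreath_act"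
proof (rule shift_action.intro)
  show "group (wreath A G)"
    by (rule group_wreath [OF A.is_group])
  show "shift_action_axioms (wreath A G) alphabet wreath_act"
  proof
    show "continuous_map (full_shift alphabet) (full_shift alphabet) (wreath_act p)"
      if "p \<in> carrier (wreath A G)" for p
      using that continuous_wreath_act by (auto simp: wreath_simps)
  next
    fix p w assume "p \<in> carrier (wreath A G)" and w: "w \<in> topspace (full_shift alphabet)"
    then obtain f g where p: "p = (f, g)" and g: "g \<in> carrier G"
      by (auto simp: wreath_simps)
    show "wreath_act p (shift w) = shift (wreath_act p w)"
    proof
      fix i
      have "\<phi> g (fst \<circ> shift w) = shift (\<phi> g (fst \<circ> w))"
        "\<psi> g (snd \<circ> snd \<circ> shift w) = shift (\<psi> g (snd \<circ> snd \<circ> w))"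
        using commute [OF g components(1) [OF w]] \<psi>.commute [OF g components(3) [OF w]]
        by (simp_all add: shift_comp)
      \<comment> \<open>On the second track, \<open>i\<close> shifts applied to the shifted point
        are \<open>Suc i\<close> shifts of the original point, which is the rule at coordinate
        \<open>Suc i\<close>.\<close>
      then show "wreath_act p (shift w) i = shift (wreath_act p w) i"
        by (simp add: p wreath_act_def shift_def [of w] shift_def [of "\<lambda>i. (_ i, _ i)"] funpow_swap1)
          (simp add: shift_def)
    qed
  next
    fix w assume w: "w \<in> topspace (full_shift alphabet)"
    show "wreath_act \<one>\<^bsub>wreath A G\<^esub> w = w"
      using components [OF w]
      by (auto simp: wreath_simps wreath_act_def act_one \<psi>.act_one cocycle_one funpow_shift_closed
          simp del: one_sum_group)
  next
    fix p q w
    assume "p \<in> carrier (wreath A G)" "q \<in> carrier (wreath A G)"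
      and w: "w \<in> topspace (full_shift alphabet)"
    then obtain f g f' g' where p: "p = (f, g)" "f \<in> carrier S" "g \<in> carrier G"
      and q: "q = (f', g')" "f' \<in> carrier S" "g' \<in> carrier G"
      by (auto simp: wreath_simps)
    show "wreath_act (p \<otimes>\<^bsub>wreath A G\<^esub> q) w = wreath_act p (wreath_act q w)"
    proof
      fix i
      let ?x = "\<phi> g' (fst \<circ> w)"
      have x: "?x \<in> topspace (full_shift \<Sigma>)"
        using act_closed components(1) [OF w] q by blast
      have tr: "translate G g f' \<in> carrier S"
        by (rule translate_closed [OF A.is_group q(2) p(3)])
      \<comment> \<open>The translate of \<open>f'\<close> is evaluated at a point moved by
        \<open>g\<close>. Equivariance cancels the two and leaves the contribution that
        \<open>q\<close> has already made at \<open>?x\<close>.\<close>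
      have "cocycle (f \<otimes>\<^bsub>S\<^esub> translate G g f') ((shift ^^ i) (\<phi> g ?x))
          = cocycle f ((shift ^^ i) (\<phi> g ?x)) \<otimes>\<^bsub>B\<^esub> cocycle f' ((shift ^^ i) ?x)"
        using p q x tr cocycle_translate [OF q(2) p(3) funpow_shift_closed [OF x]]
        by (simp add: cocycle_mult funpow_shift_closed act_closed commute_funpow del: mult_sum_group)
      moreover have "cocycle f ((shift ^^ i) (\<phi> g ?x)) \<in> carrier B"
        "cocycle f' ((shift ^^ i) ?x) \<in> carrier B" "fst (snd (w i)) \<in> carrier B"
        using p q x components(2) [OF w]
        by (simp_all add: cocycle_closed funpow_shift_closed act_closed)
      moreover have "\<phi> (g \<otimes> g') (fst \<circ> w) = \<phi> g ?x"
        "\<psi> (g \<otimes> g') (snd \<circ> snd \<circ> w) = \<psi> g (\<psi> g' (snd \<circ> snd \<circ> w))"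
        using p q components [OF w] by (simp_all add: act_mult \<psi>.act_mult)
      moreover have "fst (snd (wreath_act q w i)) = fst (snd (w i)) \<otimes>\<^bsub>B\<^esub> cocycle f' ((shift ^^ i) ?x)"
        by (simp add: q wreath_act_def)
      ultimately show "wreath_act (p \<otimes>\<^bsub>wreath A G\<^esub> q) w i = wreath_act p (wreath_act q w) i"
        unfolding p(1) q(1) wreath_simps
        by (subst (1 2) wreath_act_def)
          (simp add: wreath_act_components B.m_ac del: mult_sum_group)
    qed
  qed
qed

text \<open>The third track detects \<open>g\<close>. Once \<open>g\<close> is one, the second track
  records exactly the cocycle of \<open>f\<close> at the first track.\<close>

lemma wreath_act_faithful:
  assumes faithful: "\<And>g. \<lbrakk>g \<in> carrier G; \<And>z. z \<in> topspace (full_shift \<Lambda>) \<Longrightarrow> \<psi> g z = z\<rbrakk> \<Longrightarrow> g = \<one>"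
    and no_canc: "\<not> cancellation_wrt A G (full_shift \<Sigma>) \<phi> \<theta> B"
    and "\<Sigma> \<noteq> {}" and "\<Lambda> \<noteq> {}"
    and p: "p \<in> carrier (wreath A G)"
    and triv: "\<And>w. w \<in> topspace (full_shift alphabet) \<Longrightarrow> wreath_act p w = w"
  shows "p = \<one>\<^bsub>wreath A G\<^esub>"
proof -
  obtain f g where fg: "p = (f, g)" "f \<in> carrier S" "g \<in> carrier G"
    using p by (auto simp: wreath_simps)
  \<comment> \<open>A point with prescribed first and third tracks and the neutral letter throughout
    the second. The constant sequences below fill whichever track is not being tested.\<close>
  define W where "W = (\<lambda>x z (i :: nat). (x i, \<one>\<^bsub>B\<^esub>, z i) :: 's \<times> 'b \<times> 'l)"
  have W: "W x z \<in> topspace (full_shift alphabet)" "fst \<circ> W x z = x" "snd \<circ> snd \<circ> W x z = z"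
    if "x \<in> topspace (full_shift \<Sigma>)" "z \<in> topspace (full_shift \<Lambda>)" for x z
    using that by (auto simp: W_def topspace_full_shift fun_eq_iff)
  obtain a c where "a \<in> \<Sigma>" "c \<in> \<Lambda>"
    using \<open>\<Sigma> \<noteq> {}\<close> \<open>\<Lambda> \<noteq> {}\<close> by blast
  then have const: "(\<lambda>_. a) \<in> topspace (full_shift \<Sigma>)" "(\<lambda>_. c) \<in> topspace (full_shift \<Lambda>)"
    by (auto simp: topspace_full_shift)
  have g: "g = \<one>"
  proof (rule faithful [OF fg(3)])
    fix z assume "z \<in> topspace (full_shift \<Lambda>)"
    note W' = W [OF const(1) this]
    show "\<psi> g z = z"
      using wreath_act_components(2) [of f g "W (\<lambda>_. a) z"] triv [OF W'(1)] W' fg(1) by simp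
  qed
  have "cocycle f x = \<one>\<^bsub>B\<^esub>" if x: "x \<in> topspace (full_shift \<Sigma>)" for x
  proof -
    note W' = W [OF x const(2)]
    \<comment> \<open>At coordinate 0 no shift intervenes and the old letter is neutral, so the new
      letter is the cocycle at \<open>x\<close> itself.\<close>
    have "fst (snd (wreath_act (f, g) (W x (\<lambda>_. c)) 0)) = fst (snd (W x (\<lambda>_. c) 0))"
      using triv [OF W'(1)] fg(1) by simp
    then show ?thesis
      using x fg(2) W'(2) by (simp add: wreath_act_def g act_one cocycle_closed) (simp add: W_def cocycle_closed)
  qed
  then have "f = \<one>\<^bsub>S\<^esub>"
    by (rule cocycle_trivial_imp_one [OF no_canc fg(2)])
  with g fg(1) show ?thesis
    by (simp add: wreath_simps)
qed

end

section \<open>Assembling the embedding\<close>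

theorem theorem4:
  fixes A :: "('a, 'm) monoid_scheme"
    and G :: "('g, 'n) monoid_scheme"
    and \<Sigma> :: "'s set"
    and \<phi> :: "'g \<Rightarrow> (nat \<Rightarrow> 's) \<Rightarrow> nat \<Rightarrow> 's"
  assumes "comm_group A" and "finite (carrier A)"
    and "in_class_infinity G"
    and "finite \<Sigma>" and "card \<Sigma> \<ge> 2"
    and "\<phi> \<in> hom G (shift_Aut \<Sigma>)"
    and "\<not> cancellation A G (full_shift \<Sigma>) \<phi>"
  shows "in_class_infinity (wreath A G)"
proof -
  obtain \<Lambda> :: "nat set" and H where "group G" and \<Lambda>: "finite \<Lambda>" "card \<Lambda> \<ge> 2"
    and H: "subgroup H (shift_Aut \<Lambda>)" and "G \<cong> (shift_Aut \<Lambda>)\<lparr>carrier := H\<rparr>"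
    using \<open>in_class_infinity G\<close> unfolding in_class_infinity_def in_class_def by blast
  \<comment> \<open>The embedding \<open>\<psi>\<close> comes from membership in the class and is
    unrelated to \<open>\<phi>\<close>, which may fail to be injective. This is why a third track
    carries \<open>\<psi>\<close>.\<close>
  then obtain \<psi> where \<psi>: "\<psi> \<in> iso G ((shift_Aut \<Lambda>)\<lparr>carrier := H\<rparr>)"
    unfolding is_iso_def by blast
  interpret G: group G by fact
  have \<psi>_hom: "\<psi> \<in> hom G (shift_Aut \<Lambda>)" and \<psi>_inj: "inj_on \<psi> (carrier G)"
    using \<psi> subgroup.subset [OF H] by (auto simp: iso_def hom_def bij_betw_def)
  obtain B :: "nat monoid" and \<theta> where "comm_group B" "finite (carrier B)"
    and \<theta>: "continuous_map (full_shift \<Sigma>) (discrete_topology (Hom A B)) \<theta>"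
    and no_canc: "\<not> cancellation_wrt A G (full_shift \<Sigma>) \<phi> \<theta> B"
    using \<open>\<not> cancellation A G (full_shift \<Sigma>) \<phi>\<close> unfolding cancellation_def by blast
  interpret wreath_shift_action G \<Sigma> \<phi> A B \<theta> \<Lambda> \<psi>
    by (intro wreath_shift_action.intro hom_valued_shift_action.intro
        hom_valued_shift_action_axioms.intro hom_shift_Aut_imp_shift_action) fact+
  have faithful: "g = \<one>\<^bsub>G\<^esub>"
    if g: "g \<in> carrier G" and triv: "\<And>z. z \<in> topspace (full_shift \<Lambda>) \<Longrightarrow> \<psi> g z = z" for g
  proof -
    \<comment> \<open>Being extensional, \<open>\<psi> g\<close> is the identity element as soon as
      it fixes every point of the space. Only then can injectivity of \<open>\<psi>\<close> be
      applied.\<close>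
    have "\<psi> g \<in> extensional (topspace (full_shift \<Lambda>))"
      using hom_in_carrier [OF \<psi>_hom g] by (auto simp: shift_auts_def Bij_def)
    then have "\<psi> g = \<one>\<^bsub>shift_Aut \<Lambda>\<^esub>"
      unfolding one_shift_Aut by (rule extensionalityI) (simp_all add: triv)
    also have "\<dots> = \<psi> \<one>\<^bsub>G\<^esub>"
      using hom_one [OF \<psi>_hom \<open>group G\<close> group_shift_Aut] by simp
    finally show ?thesis
      using inj_onD [OF \<psi>_inj _ g G.one_closed] by simp
  qed
  have "\<Sigma> \<noteq> {}" "\<Lambda> \<noteq> {}"
    using \<open>card \<Sigma> \<ge> 2\<close> \<Lambda>(2) by auto
  show ?thesis
  proof (rule faithful_shift_action_imp_in_class_infinity [OF shift_action_wreath])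
    show "finite alphabet"
      using \<open>finite \<Sigma>\<close> \<open>finite (carrier B)\<close> \<Lambda>(1) by simp
    \<comment> \<open>The group \<open>B\<close> may be trivial; its neutral element already keeps
      the product alphabet at two or more letters.\<close>
    have "card (carrier B) \<ge> 1"
      using \<open>finite (carrier B)\<close> B.one_closed by (metis One_nat_def Suc_leI card_gt_0_iff empty_iff)
    then have "2 * (1 * 1) \<le> card \<Sigma> * (card (carrier B) * card \<Lambda>)"
      using \<open>card \<Sigma> \<ge> 2\<close> \<Lambda>(2) by (intro mult_le_mono) auto
    then show "card alphabet \<ge> 2"
      by (simp add: card_cartesian_product)
  qed (rule wreath_act_faithful [OF faithful no_canc \<open>\<Sigma> \<noteq> {}\<close> \<open>\<Lambda> \<noteq> {}\<close>])
qed

end
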